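(* Let $\mathcal{X}$ be a non-empty finite set, and let $\check n,\hat n\geq1$ be integers with $N=\check n+\hat n$. Let $\check x\in\mathcal{X}^{\check n}$ and let $\mathcal{R}\subseteq\mathcal{G}(\mathcal{X}^N)$ be a coherent and exchangeable set of gambles on $\mathcal{X}^N$. Then $$\mathcal{R}\rfloor\check x:=\{f\in\mathcal{G}(\mathcal{X}^{\hat n}): fI_{C_{\check x}}\in\mathcal{R}\}$$ is a coherent and exchangeable set of gambles on $\mathcal{X}^{\hat n}$.
   Context: A gamble on a non-empty set $\Omega$ is a bounded function $\Omega\to\mathbb{R}$; $\mathcal{G}(\Omega)$ is the linear space of all gambles on $\Omega$. Write $f\geq g$ for the pointwise ordering, and $f>g$ iff $f\geq g$ and $f\neq g$. A set $\mathcal{R}\subseteq\mathcal{G}(\Omega)$ is coherent if: $0\notin\mathcal{R}$; $f>0$ implies $f\in\mathcal{R}$; $f\in\mathcal{R}$ and $\lambda>0$ imply $\lambda f\in\mathcal{R}$; $f_1,f_2\in\mathcal{R}$ implies $f_1+f_2\in\mathcal{R}$. For $n\geq1$ and a permutation $\pi$ of $\{1,\dots,n\}$ put $\pi(x_1,\dots,x_n)=(x_{\pi(1)},\dots,x_{\pi(n)})$ and $\pi^tf=f\circ\pi$. A coherent set $\mathcal{R}\subseteq\mathcal{G}(\mathcal{X}^n)$ is exchangeable if $h+(f-\pi^tf)\in\mathcal{R}$ for all $h\in\mathcal{R}$, $f\in\mathcal{G}(\mathcal{X}^n)$ and all permutations $\pi$ of $\{1,\dots,n\}$. $C_{\check x}=\{\check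 x\}\times\mathcal{X}^{\hat n}\subseteq\mathcal{X}^N$, $I_C$ is the indicator function of $C$, and for $f\in\mathcal{G}(\mathcal{X}^{\hat n})$ the gamble $fI_{C_{\check x}}$ on $\mathcal{X}^N$ is $(y,z)\mapsto f(z)I_{C_{\check x}}(y,z)$ for $y\in\mathcal{X}^{\check n}$, $z\in\mathcal{X}^{\hat n}$. *)

theory Defs
  imports
    "HOL-Analysis.Analysis"
    "HOL-Combinatorics.List_Permutation"
    "HOL-Library.NList"
begin

text \<open>
  A bounded real function on \<open>\<Omega>\<close> is represented by its extension by zero to the ambient
  type. This makes gambles on \<open>\<Omega>\<close> a linear space under the pointwise operations, with zero
  \<open>\<lambda>_. 0\<close>, and makes equality and the library order on functions agree with
  equality and pointwise order on \<open>\<Omega>\<close>.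
\<close>

definition gambles :: "'a set \<Rightarrow> ('a \<Rightarrow> real) set" where
  "gambles \<Omega> = {f. bounded (f ` \<Omega>) \<and> (\<forall>\<omega>. \<omega> \<notin> \<Omega> \<longrightarrow> f \<omega> = 0)}"

lemma gambles_eq_iff:
  assumes "f \<in> gambles \<Omega>" and "g \<in> gambles \<Omega>"
  shows "f = g \<longleftrightarrow> (\<forall>\<omega>\<in>\<Omega>. f \<omega> = g \<omega>)"
proof -
  have "f \<omega> = g \<omega>" if "\<omega> \<notin> \<Omega>" for \<omega>
    using that assms by (simp add: gambles_def)
  then show ?thesis
    unfolding fun_eq_iff by blast
qed

lemma gambles_less_iff:
  "f \<in> gambles \<Omega> \<Longrightarrow> g \<in> gambles \<Omega> \<Longrightarrow> g < f \<longleftrightarrow> (\<forall>\<omega>\<in>\<Omega>. g \<omega> \<le> f \<omega>) \<and> f \<noteq> g"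
proof -
  assume "f \<in> gambles \<Omega>" "g \<in> gambles \<Omega>"
  then have "g \<omega> \<le> f \<omega>" if "\<omega> \<notin> \<Omega>" for \<omega>
    using that by (simp add: gambles_def)
  then have "g \<le> f \<longleftrightarrow> (\<forall>\<omega>\<in>\<Omega>. g \<omega> \<le> f \<omega>)"
    unfolding le_fun_def by blast
  then show ?thesis
    unfolding order.strict_iff_order by blast
qed

definition coherent :: "'a set \<Rightarrow> ('a \<Rightarrow> real) set \<Rightarrow> bool" where
  "coherent \<Omega> R \<longleftrightarrow>
     R \<subseteq> gambles \<Omega> \<and>
     (\<lambda>_. 0) \<notin> R \<and>
     (\<forall>f\<in>gambles \<Omega>. (\<lambda>_. 0) < f \<longrightarrow> f \<in> R) \<and>
     (\<forall>f\<in>R. \<forall>c>0. (\<lambda>\<omega>. c * f \<omega>) \<in> R) \<and>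
     (\<forall>f\<in>R. \<forall>g\<in>R. (\<lambda>\<omega>. f \<omega> + g \<omega>) \<in> R)"

text \<open>
  \<open>X\<^sup>n\<close> is rendered as \<open>nlists n X\<close>, the lists of length \<open>n\<close> over \<open>X\<close>, with indices
  \<open>0, \<dots>, n - 1\<close>. For \<open>\<pi> permutes {..<n}\<close>, the \<open>i\<close>-th entry of
  \<open>permute_list \<pi> x\<close> is \<open>x ! \<pi> i\<close>.
\<close>

definition perm_transpose :: "(nat \<Rightarrow> nat) \<Rightarrow> ('x list \<Rightarrow> real) \<Rightarrow> 'x list \<Rightarrow> real" where
  "perm_transpose \<pi> f = f \<circ> permute_list \<pi>"

lemma perm_transpose_gambles:
  assumes "\<pi> permutes {..<n}" and "f \<in> gambles (nlists n X)"
  shows "perm_transpose \<pi> f \<in> gambles (nlists n X)"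
proof -
  have *: "permute_list \<pi> x \<in> nlists n X \<longleftrightarrow> x \<in> nlists n X" for x
  proof (cases "length x = n")
    case True
    then have "set (permute_list \<pi> x) = set x"
      using assms(1) by (intro set_permute_list) blast
    then show ?thesis
      by (simp only: nlists_def mem_Collect_eq length_permute_list)
  next
    case False
    then show ?thesis
      by (simp only: nlists_def mem_Collect_eq length_permute_list) blast
  qed
  have "(f \<circ> permute_list \<pi>) ` nlists n X \<subseteq> f ` nlists n X"
    unfolding image_comp[symmetric] using * by (intro image_mono) blast
  moreover have "bounded (f ` nlists n X)" and "\<And>x. x \<notin> nlists n X \<Longrightarrow> f x = 0"
    using assms(2) by (simp_all add: gambles_def)
  ultimately show ?thesis
    unfolding gambles_def perm_transpose_def mem_Collect_eq o_def
    using * by (meson bounded_subset)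
qed

definition exchangeable :: "'x set \<Rightarrow> nat \<Rightarrow> ('x list \<Rightarrow> real) set \<Rightarrow> bool" where
  "exchangeable X n R \<longleftrightarrow>
     (\<forall>h\<in>R. \<forall>f\<in>gambles (nlists n X). \<forall>\<pi>. \<pi> permutes {..<n} \<longrightarrow>
        (\<lambda>x. h x + (f x - perm_transpose \<pi> f x)) \<in> R)"

definition cylinder :: "'x set \<Rightarrow> nat \<Rightarrow> 'x list \<Rightarrow> 'x list set" where
  "cylinder X m y = {y @ z | z. z \<in> nlists m X}"

text \<open>
  The identification of \<open>X\<^sup>k \<times> X\<^sup>m\<close> with \<open>X\<^bsup>k+m\<^esup>\<close> is list concatenation, so
  \<open>drop k\<close> is the second projection.
\<close>

definition cylinder_gamble ::
    "'x set \<Rightarrow> nat \<Rightarrow> 'x list \<Rightarrow> ('x list \<Rightarrow> real) \<Rightarrow> 'x list \<Rightarrow> real" where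
  "cylinder_gamble X m x f = (\<lambda>w. f (drop (length x) w) * indicator (cylinder X m x) w)"

lemma cylinder_gamble_append:
  "length y = length x \<Longrightarrow>
     cylinder_gamble X m x f (y @ z) = f z * indicator (cylinder X m x) (y @ z)"
  by (simp add: cylinder_gamble_def)

definition updated ::
    "'x set \<Rightarrow> nat \<Rightarrow> ('x list \<Rightarrow> real) set \<Rightarrow> 'x list \<Rightarrow> ('x list \<Rightarrow> real) set" where
  "updated X m R x = {f \<in> gambles (nlists m X). cylinder_gamble X m x f \<in> R}"

end

theory Submission
  imports Defs
begin

text \<open>
  The map \<open>f \<mapsto> f I\<^bsub>C\<^esub>\<close> is linear and injective, preserves the order, and intertwines a permutation
  of the last coordinates with its extension that fixes the first ones. Hence coherence and
  exchangeability pull back along it.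
\<close>

definition shift_perm :: "nat \<Rightarrow> (nat \<Rightarrow> nat) \<Rightarrow> nat \<Rightarrow> nat" where
  "shift_perm k \<pi> i = (if i < k then i else k + \<pi> (i - k))"

text \<open>From index \<open>k\<close> on, the inner map returns \<open>k + q (i - k)\<close>,
  again at least \<open>k\<close>, so the outer map stays in its second branch and the offset
  cancels. This makes the shift of an inverse an inverse of the shift.\<close>

lemma shift_perm_comp: "shift_perm k p \<circ> shift_perm k q = shift_perm k (p \<circ> q)"
  by (auto simp: fun_eq_iff shift_perm_def)

lemma shift_perm_id: "shift_perm k id = id"
  by (auto simp: fun_eq_iff shift_perm_def)

lemma shift_perm_permutes:
  assumes "\<pi> permutes {..<m}"
  shows "shift_perm k \<pi> permutes {..<k + m}"
proof -
  have "bij (shift_perm k \<pi>)"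
    by (rule o_bij[of "shift_perm k (inv \<pi>)"])
      (simp_all only: shift_perm_comp permutes_inv_o[OF assms] shift_perm_id)
  \<comment> \<open>For \<open>i \<ge> k + m\<close> the index \<open>i - k\<close> is at least
    \<open>m\<close>, hence fixed by \<open>\<pi>\<close>.\<close>
  moreover have "shift_perm k \<pi> i = i" if "i \<notin> {..<k + m}" for i
    using that permutes_not_in[OF assms, of "i - k"] by (auto simp: shift_perm_def)
  ultimately show ?thesis
    unfolding permutes_def bij_iff by blast
qed

text \<open>At positions \<open>i \<ge> k\<close> both sides read \<open>w\<close> at
  \<open>k + \<pi> (i - k)\<close>. The bound on \<open>k\<close> turns \<open>drop k w ! j\<close>
  into \<open>w ! (k + j)\<close> for every \<open>j\<close>, even one out of range.\<close>

lemma permute_list_shift_perm: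
  assumes "k \<le> length w"
  shows "permute_list (shift_perm k \<pi>) w = take k w @ permute_list \<pi> (drop k w)"
  using assms
  by (intro nth_equalityI) (simp_all add: permute_list_def shift_perm_def nth_append not_less diff_less_mono)

text \<open>Since \<open>f\<close> is extended by zero, a tail outside \<open>nlists m X\<close>
  contributes 0 anyway. Membership in the cylinder thus reduces to a test on the prefix
  alone.\<close>

lemma cylinder_gamble_eq:
  assumes "f \<in> gambles (nlists m X)"
  shows "cylinder_gamble X m x f w =
    (if take (length x) w = x then f (drop (length x) w) else 0)"
proof -
  have "w \<in> cylinder X m x \<longleftrightarrow>
      take (length x) w = x \<and> drop (length x) w \<in> nlists m X"
  proof
    assume "w \<in> cylinder X m x"
    then obtain z where "w = x @ z" "z \<in> nlists m X"
      unfolding cylinder_def by blast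
    then show "take (length x) w = x \<and> drop (length x) w \<in> nlists m X"
      by simp
  next
    assume *: "take (length x) w = x \<and> drop (length x) w \<in> nlists m X"
    have "w = take (length x) w @ drop (length x) w"
      by (rule append_take_drop_id[symmetric])
    also have "take (length x) w = x"
      using * by (rule conjunct1)
    finally show "w \<in> cylinder X m x"
      using * unfolding cylinder_def by blast
  qed
  moreover have "f z = 0" if "z \<notin> nlists m X" for z
    using assms that unfolding gambles_def by blast
  ultimately show ?thesis
    by (auto simp: cylinder_gamble_def indicator_def)
qed

lemma cylinder_gamble_in_gambles:
  assumes "x \<in> nlists k X" and f: "f \<in> gambles (nlists m X)"
  shows "cylinder_gamble X m x f \<in> gambles (nlists (k + m) X)"
proof -
  \<comment> \<open>Stated for every list \<open>z\<close>, so that it applies to the tail of any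
    \<open>w\<close>; the added 0 also serves as the value off the cylinder.\<close>
  have range: "f z \<in> insert 0 (f ` nlists m X)" for z
    using f by (cases "z \<in> nlists m X") (simp_all add: gambles_def)
  have "cylinder_gamble X m x f ` nlists (k + m) X \<subseteq> insert 0 (f ` nlists m X)"
  proof (rule image_subsetI)
    fix w
    show "cylinder_gamble X m x f w \<in> insert 0 (f ` nlists m X)"
      unfolding cylinder_gamble_eq[OF f] using range by (cases "take (length x) w = x") simp_all
  qed
  moreover have "bounded (insert 0 (f ` nlists m X))"
    using f by (simp add: gambles_def)
  ultimately have bdd: "bounded (cylinder_gamble X m x f ` nlists (k + m) X)"
    by (rule bounded_subset[rotated])
  have "cylinder X m x \<subseteq> nlists (k + m) X"
    using nlists_appendI[OF assms(1)] by (auto simp: cylinder_def)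
  then have "cylinder_gamble X m x f w = 0" if "w \<notin> nlists (k + m) X" for w
    using that by (auto simp: cylinder_gamble_def indicator_def)
  then show ?thesis
    using bdd unfolding gambles_def by blast
qed

lemma cylinder_gamble_less:
  assumes f: "f \<in> gambles (nlists m X)" and "(\<lambda>_. 0) < f"
  shows "(\<lambda>_. 0) < cylinder_gamble X m x f"
proof -
  have "0 \<le> f z" for z
    using assms(2) by (simp add: less_fun_def le_fun_def)
  \<comment> \<open>Strictness: a point where \<open>f\<close> is positive becomes, once prefixed by
    \<open>x\<close>, a point of the cylinder where the lifted gamble has the same value.\<close>
  moreover obtain z where "0 < f z"
    using assms(2) by (auto simp: less_fun_def le_fun_def not_le)
  then have "0 < cylinder_gamble X m x f (x @ z)"
    by (simp add: cylinder_gamble_eq[OF f])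
  then have "\<not> cylinder_gamble X m x f \<le> (\<lambda>_. 0)"
    by (auto simp: le_fun_def not_le)
  ultimately show ?thesis
    by (simp add: less_fun_def le_fun_def[of "\<lambda>_. 0"] cylinder_gamble_eq[OF f])
qed

lemma cylinder_gamble_zero: "cylinder_gamble X m x (\<lambda>_. 0) = (\<lambda>_. 0)"
  by (simp add: cylinder_gamble_def)

lemma cylinder_gamble_scale:
  "cylinder_gamble X m x (\<lambda>z. c * f z) = (\<lambda>w. c * cylinder_gamble X m x f w)"
  by (simp add: cylinder_gamble_def mult.assoc)

lemma cylinder_gamble_add:
  "cylinder_gamble X m x (\<lambda>z. f z + g z) =
    (\<lambda>w. cylinder_gamble X m x f w + cylinder_gamble X m x g w)"
  by (simp add: cylinder_gamble_def distrib_right)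

lemma cylinder_gamble_diff:
  "cylinder_gamble X m x (\<lambda>z. f z - g z) =
    (\<lambda>w. cylinder_gamble X m x f w - cylinder_gamble X m x g w)"
  by (simp add: cylinder_gamble_def left_diff_distrib)

text \<open>The shifted permutation keeps the prefix, so the test against \<open>x\<close> is
  unaffected, and it acts as \<open>\<pi>\<close> on the tail, which is all that \<open>f\<close>
  sees.\<close>

lemma cylinder_gamble_perm_transpose:
  assumes f: "f \<in> gambles (nlists m X)" and \<pi>: "\<pi> permutes {..<m}"
  shows "cylinder_gamble X m x (perm_transpose \<pi> f) =
    perm_transpose (shift_perm (length x) \<pi>) (cylinder_gamble X m x f)"
proof
  fix w
  show "cylinder_gamble X m x (perm_transpose \<pi> f) w =
    perm_transpose (shift_perm (length x) \<pi>) (cylinder_gamble X m x f) w"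
  proof (cases "length x \<le> length w")
    case True
    then show ?thesis
      using permute_list_shift_perm[OF True, of \<pi>]
      by (simp add: cylinder_gamble_eq[OF f] cylinder_gamble_eq[OF perm_transpose_gambles[OF \<pi> f]])
        (simp add: perm_transpose_def cylinder_gamble_eq[OF f])
  next
    case False
    \<comment> \<open>A list shorter than \<open>x\<close> cannot start with \<open>x\<close>, and
      permuting keeps the length, so both sides are 0.\<close>
    then have "take (length x) v \<noteq> x" if "length v = length w" for v
      using that by (auto dest: arg_cong[of _ _ length])
    then show ?thesis
      by (simp add: cylinder_gamble_eq[OF perm_transpose_gambles[OF \<pi> f]])
        (simp add: perm_transpose_def cylinder_gamble_eq[OF f])
  qed
qed

text \<open>Membership in \<open>updated\<close> asks for a gamble as well as for its lift to lie in
  \<open>R\<close>, so \<open>gambles\<close> must itself be closed under the operations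
  used.\<close>

lemma gambles_scale: "f \<in> gambles \<Omega> \<Longrightarrow> (\<lambda>\<omega>. c * f \<omega>) \<in> gambles \<Omega>"
  using bounded_scaling[of "f ` \<Omega>" c] by (simp add: gambles_def image_image)

lemma gambles_add:
  "f \<in> gambles \<Omega> \<Longrightarrow> g \<in> gambles \<Omega> \<Longrightarrow> (\<lambda>\<omega>. f \<omega> + g \<omega>) \<in> gambles \<Omega>"
  by (simp add: gambles_def bounded_plus_comp)

lemma gambles_diff:
  "f \<in> gambles \<Omega> \<Longrightarrow> g \<in> gambles \<Omega> \<Longrightarrow> (\<lambda>\<omega>. f \<omega> - g \<omega>) \<in> gambles \<Omega>"
  by (simp add: gambles_def bounded_minus_comp)

lemma coherent_updated:
  assumes x: "x \<in> nlists k X" and R: "coherent (nlists (k + m) X) R"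
  shows "coherent (nlists m X) (updated X m R x)"
  unfolding coherent_def
proof (intro conjI ballI allI impI)
  show "updated X m R x \<subseteq> gambles (nlists m X)"
    by (auto simp: updated_def)
  show "(\<lambda>_. 0) \<notin> updated X m R x"
    using R by (simp add: coherent_def updated_def cylinder_gamble_zero)
  show "f \<in> updated X m R x" if "f \<in> gambles (nlists m X)" "(\<lambda>_. 0) < f" for f
    using that R cylinder_gamble_in_gambles[OF x that(1)] cylinder_gamble_less[OF that]
    by (simp add: coherent_def updated_def)
  show "(\<lambda>z. c * f z) \<in> updated X m R x" if "f \<in> updated X m R x" "0 < c" for f c
    using that R by (simp add: coherent_def updated_def cylinder_gamble_scale gambles_scale)
  show "(\<lambda>z. f z + g z) \<in> updated X m R x"
    if "f \<in> updated X m R x" "g \<in> updated X m R x" for f g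
    using that R by (simp add: coherent_def updated_def cylinder_gamble_add gambles_add)
qed

lemma exchangeable_updated:
  assumes x: "x \<in> nlists k X" and R: "exchangeable X (k + m) R"
  shows "exchangeable X m (updated X m R x)"
  unfolding exchangeable_def
proof (intro ballI allI impI)
  fix h f \<pi>
  assume h: "h \<in> updated X m R x" and f: "f \<in> gambles (nlists m X)" and \<pi>: "\<pi> permutes {..<m}"
  let ?c = "cylinder_gamble X m x"
  have [simp]: "length x = k"
    using x by (rule nlistsE_length)
  \<comment> \<open>Exchangeability of \<open>R\<close> is applied to the lifts of \<open>h\<close>
    and \<open>f\<close> and to the shifted permutation. By intertwining and linearity the result is
    the lift of \<open>h + (f - perm_transpose \<pi> f)\<close>.\<close>
  have "(\<lambda>w. ?c h w + (?c f w - perm_transpose (shift_perm k \<pi>) (?c f) w)) \<in> R"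
    using R h cylinder_gamble_in_gambles[OF x f] shift_perm_permutes[OF \<pi>, of k]
    by (simp add: exchangeable_def updated_def)
  then show "(\<lambda>z. h z + (f z - perm_transpose \<pi> f z)) \<in> updated X m R x"
    using h f perm_transpose_gambles[OF \<pi> f]
    by (simp add: updated_def cylinder_gamble_add cylinder_gamble_diff
        cylinder_gamble_perm_transpose[OF f \<pi>] gambles_add gambles_diff)
qed

theorem proposition15:
  fixes X :: "'x set" and nc nh N :: nat
    and xc :: "'x list" and R :: "('x list \<Rightarrow> real) set"
  assumes "finite X" and "X \<noteq> {}"
    and "nc \<ge> 1" and "nh \<ge> 1" and "N = nc + nh"
    and "xc \<in> nlists nc X"
    and "coherent (nlists N X) R" and "exchangeable X N R"
  shows "coherent (nlists nh X) (updated X nh R xc) \<and> exchangeable X nh (updated X nh R xc)"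
  using coherent_updated[OF assms(6)] exchangeable_updated[OF assms(6)] assms(7,8)
  unfolding assms(5) by (intro conjI)

end
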